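(* Let $m,n$ be positive integers with $m<2^n$. Consider the following game. Kronecker holds a list of $m$ vectors $v_1,\ldots,v_m\in\{0,1\}^n$, unknown to Cantor. Cantor must declare in advance (obliviously, before receiving any answer) a set of queries, each of the form ``what is bit number $j$ of vector number $i$?'' (for $1\le i\le m$, $1\le j\le n$); Kronecker then answers all of them truthfully, and Cantor must output a vector $u\in\{0,1\}^n$ with $u\neq v_i$ for all $1\le i\le m$. Let $f(n,m)$ be the smallest number $q$ such that there is a set of at most $q$ queries with which Cantor can, for every list $v_1,\ldots,v_m$, output such a vector $u$ (as a function of the answers). Then, with all logarithms to base $2$, \[ f(n,m)=\begin{cases} m & \text{if } m\le n,\\ m\Bigl(\log\bigl\lceil \tfrac{m}{n}\bigr\rceil + o\bigl(\log\bigl\lceil\tfrac mn\bigr\rceil\bigr)\Bigr) & \text{if } n<m<2^n.\end{cases} \] Quantitatively, for all $n<m<2^n$, \[ m\Bigl(\log\Bigl(\frac{m}{n-\log m+1}\Bigr)-1\Bigr)\;\le\; f(n,m)\;\le\; m\Bigl\lceil \log\Bigl(\frac{2m}{n}\Bigr)+2\log\Bigl(\log\Bigl(\frac{2m}{n}\Bigr)\Bigr)+1\Bigr\rceil . \] *)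

theory Defs
  imports Complex_Main "HOL-Library.FuncSet" "HOL-Library.Landau_Symbols"
begin

definition bitvecs :: "nat \<Rightarrow> (nat \<Rightarrow> nat) set" where
  "bitvecs n = {1..n} \<rightarrow>\<^sub>E {0, 1}"

text \<open>A query \<open>(i, j)\<close> asks for bit number \<open>j\<close> of vector number \<open>i\<close>.  Outside the query set \<open>Q\<close>
  the table of answers is undefined, so a function of it depends on the queried bits only.\<close>

definition answers :: "(nat \<times> nat) set \<Rightarrow> (nat \<Rightarrow> nat \<Rightarrow> nat) \<Rightarrow> nat \<times> nat \<Rightarrow> nat" where
  "answers Q v = restrict (\<lambda>(i, j). v i j) Q"

definition cantor_wins :: "nat \<Rightarrow> nat \<Rightarrow> (nat \<times> nat) set \<Rightarrow> bool" where
  "cantor_wins n m Q \<longleftrightarrow>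
     (\<exists>out :: (nat \<times> nat \<Rightarrow> nat) \<Rightarrow> (nat \<Rightarrow> nat).
        \<forall>v \<in> {1..m} \<rightarrow>\<^sub>E bitvecs n.
          out (answers Q v) \<in> bitvecs n \<and> (\<forall>i\<in>{1..m}. out (answers Q v) \<noteq> v i))"

definition oblivious_queries :: "nat \<Rightarrow> nat \<Rightarrow> nat" where
  "oblivious_queries n m =
     (LEAST q. \<exists>Q. Q \<subseteq> {1..m} \<times> {1..n} \<and> card Q \<le> q \<and> cantor_wins n m Q)"

text \<open>The minimum is attained when \<open>m < 2 ^ n\<close>: asking for all bits suffices.\<close>

lemma card_bitvecs: "card (bitvecs n) = 2 ^ n"
  unfolding bitvecs_def by (simp add: card_PiE numeral_2_eq_2)

lemma cantor_wins_all_queries: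
  assumes "m < 2 ^ n"
  shows "cantor_wins n m ({1..m} \<times> {1..n})"
proof -
  let ?Q = "{1..m} \<times> {1..n}"
  define bad where
    "bad a = (\<lambda>i. \<lambda>j\<in>{1..n}. a (i, j)) ` {1..m}" for a :: "nat \<times> nat \<Rightarrow> nat"
  define out where "out a = (SOME u. u \<in> bitvecs n - bad a)" for a
  have out: "out a \<in> bitvecs n - bad a" for a
  proof -
    have "card (bad a) \<le> m"
      unfolding bad_def by (metis card_atLeastAtMost card_image_le diff_Suc_1 finite_atLeastAtMost)
    moreover have "finite (bad a)" by (simp add: bad_def)
    ultimately have "\<not> bitvecs n \<subseteq> bad a"
      using assms card_mono[of "bad a" "bitvecs n"] by (auto simp: card_bitvecs)
    then show ?thesis unfolding out_def by (metis DiffI someI subsetI)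
  qed
  have "v i \<in> bad (answers ?Q v)" if v: "v \<in> {1..m} \<rightarrow>\<^sub>E bitvecs n" and i: "i \<in> {1..m}" for v i
  proof -
    have "v i \<in> extensional {1..n}"
      using PiE_mem[OF v i] by (auto simp: bitvecs_def PiE_def)
    then have "v i = (\<lambda>j\<in>{1..n}. answers ?Q v (i, j))"
      using i by (intro ext) (auto simp: answers_def extensional_def restrict_def)
    then show ?thesis using i unfolding bad_def by blast
  qed
  then show ?thesis
    unfolding cantor_wins_def using out by (intro exI[of _ out]) (metis Diff_iff)
qed

lemma oblivious_queries_attained:
  assumes "m < 2 ^ n"
  shows "\<exists>Q. Q \<subseteq> {1..m} \<times> {1..n} \<and> card Q \<le> oblivious_queries n m \<and> cantor_wins n m Q"
  unfolding oblivious_queries_def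
  by (rule LeastI_ex) (use cantor_wins_all_queries[OF assms] in blast)

text \<open>The pairs \<open>(n, m)\<close> with \<open>n < m < 2 ^ n\<close>, along \<open>m / n \<longrightarrow> \<infinity>\<close>: a little-o estimate in terms of
  \<open>m / n\<close> is an estimate that is uniform over all such pairs with \<open>m / n\<close> large.\<close>

definition large_ratio :: "(nat \<times> nat) filter" where
  "large_ratio =
     inf (filtercomap (\<lambda>(n, m). real m / real n) at_top)
         (principal {(n, m). 0 < n \<and> n < m \<and> m < 2 ^ n})"

end

theory Submission
  imports Defs "HOL-Analysis.Harmonic_Numbers" "HOL-Real_Asymp.Real_Asymp"
begin

text \<open>Cantor wins iff, for every table of vectors, some \<open>u\<close> differs from each \<open>v i\<close> in a queried bit,
  that is, iff the subcubes of vectors agreeing with \<open>v i\<close> on the queried bits never cover the cube.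

  Upper bound: cut the coordinates into disjoint blocks of size \<open>d\<close>. Within one block Cantor can
  evade \<open>2 ^ d - 1\<close> vectors, so assigning that many vectors to each block and querying every vector
  on its own block handles \<open>(n div d) * (2 ^ d - 1)\<close> vectors at cost \<open>d\<close> each.

  Lower bound: let \<open>d i\<close> be the number of bits queried in vector \<open>i\<close>. Kronecker chooses vectors
  greedily so that the \<open>i\<close>-th one covers at least the fraction \<open>2 powr - d i\<close> of what is still
  uncovered. A half of the vectors carrying at least half of the weight \<open>\<Sum>i. 2 powr - d i\<close>, which is
  large by convexity, leaves fewer than \<open>m / 2\<close> points, and the remaining vectors cover those one
  by one.\<close>

section \<open>Winning query sets as non-coverability by subcubes\<close>

lemma finite_bitvecs: "finite (bitvecs n)"
  unfolding bitvecs_def by (intro finite_PiE) auto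

text \<open>If the output agreed with \<open>v i\<close> on every queried bit of vector
  \<open>i\<close>, Kronecker could replace \<open>v i\<close> by that output without changing any
  answer, and Cantor would lose. Conversely, the condition on \<open>u\<close> involves only
  answered bits, so \<open>u\<close> can be chosen as a function of the answers.\<close>

lemma cantor_wins_iff:
  assumes Q: "Q \<subseteq> {1..m} \<times> {1..n}"
  shows "cantor_wins n m Q \<longleftrightarrow>
    (\<forall>v \<in> {1..m} \<rightarrow>\<^sub>E bitvecs n. \<exists>u\<in>bitvecs n. \<forall>i\<in>{1..m}. \<exists>j. (i, j) \<in> Q \<and> u j \<noteq> v i j)"
    (is "_ \<longleftrightarrow> ?R")
proof
  assume "cantor_wins n m Q"
  then obtain out where "\<forall>v \<in> {1..m} \<rightarrow>\<^sub>E bitvecs n.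
      out (answers Q v) \<in> bitvecs n \<and> (\<forall>i\<in>{1..m}. out (answers Q v) \<noteq> v i)"
    unfolding cantor_wins_def by (elim exE)
  then have out: "\<And>v. v \<in> {1..m} \<rightarrow>\<^sub>E bitvecs n \<Longrightarrow> out (answers Q v) \<in> bitvecs n"
    "\<And>v i. v \<in> {1..m} \<rightarrow>\<^sub>E bitvecs n \<Longrightarrow> i \<in> {1..m} \<Longrightarrow> out (answers Q v) \<noteq> v i"
    by simp_all
  show ?R
  proof
    fix v assume v: "v \<in> {1..m} \<rightarrow>\<^sub>E bitvecs n"
    let ?u = "out (answers Q v)"
    have "\<exists>j. (i, j) \<in> Q \<and> ?u j \<noteq> v i j" if i: "i \<in> {1..m}" for i
    proof (rule ccontr)
      assume c: "\<not> ?thesis"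
      let ?v = "v(i := ?u)"
      have mem: "?v \<in> {1..m} \<rightarrow>\<^sub>E bitvecs n"
        using v i out(1)[OF v] by (auto simp: PiE_def extensional_def)
      have "answers Q ?v = answers Q v"
        using c by (auto simp: answers_def restrict_def fun_eq_iff)
      then show False using out(2)[OF mem i] by simp
    qed
    then show "\<exists>u\<in>bitvecs n. \<forall>i\<in>{1..m}. \<exists>j. (i, j) \<in> Q \<and> u j \<noteq> v i j"
      using out(1)[OF v] by blast
  qed
next
  assume R: ?R
  define P where "P a u \<longleftrightarrow> u \<in> bitvecs n \<and> (\<forall>i\<in>{1..m}. \<exists>j. (i, j) \<in> Q \<and> u j \<noteq> a (i, j))"
    for a :: "nat \<times> nat \<Rightarrow> nat" and u
  have "P (answers Q v) (Eps (P (answers Q v)))" if v: "v \<in> {1..m} \<rightarrow>\<^sub>E bitvecs n" for v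
  proof (rule someI_ex[of "P (answers Q v)"])
    obtain u where "u \<in> bitvecs n" "\<forall>i\<in>{1..m}. \<exists>j. (i, j) \<in> Q \<and> u j \<noteq> v i j"
      using R v by blast
    then have "P (answers Q v) u" unfolding P_def answers_def by fastforce
    then show "\<exists>u. P (answers Q v) u" by blast
  qed
  then show "cantor_wins n m Q"
    unfolding cantor_wins_def
    by (intro exI[of _ "\<lambda>a. Eps (P a)"]) (force simp: P_def answers_def)
qed

lemma oblivious_queries_le:
  assumes "Q \<subseteq> {1..m} \<times> {1..n}" "card Q \<le> q" "cantor_wins n m Q"
  shows "oblivious_queries n m \<le> q"
  unfolding oblivious_queries_def using assms by (intro Least_le) blast

subsection \<open>Upper bound\<close>

text \<open>Here \<open>p\<close> colours the coordinates and \<open>c\<close> assigns a colour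
  class to each vector. Fewer vectors than bit patterns are assigned to a class, so some pattern on
  it is missed; the missed patterns glue to one \<open>u\<close> because the classes are disjoint.
  An empty class has one pattern, so the hypothesis assigns no vector to it.\<close>

lemma cantor_wins_partition:
  fixes p c :: "nat \<Rightarrow> nat"
  assumes few: "\<And>k. card {i\<in>{1..m}. c i = k} < 2 ^ card {j\<in>{1..n}. p j = k}"
  shows "cantor_wins n m (SIGMA i:{1..m}. {j\<in>{1..n}. p j = c i})"
proof (subst cantor_wins_iff; (intro ballI)?)
  fix v assume v: "v \<in> {1..m} \<rightarrow>\<^sub>E bitvecs n"
  define B where "B k = {j\<in>{1..n}. p j = k}" for k
  have "\<exists>w. w \<in> (B k \<rightarrow>\<^sub>E {0, 1::nat}) - (\<lambda>i. restrict (v i) (B k)) ` {i\<in>{1..m}. c i = k}" for k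
  proof -
    let ?I = "(\<lambda>i. restrict (v i) (B k)) ` {i\<in>{1..m}. c i = k}"
    have "card ?I \<le> card {i\<in>{1..m}. c i = k}" by (intro card_image_le) auto
    also have "\<dots> < 2 ^ card (B k)" using few unfolding B_def .
    also have "\<dots> = card (B k \<rightarrow>\<^sub>E {0, 1::nat})"
      by (subst card_PiE) (auto simp: B_def numeral_2_eq_2)
    finally have "card ?I < card (B k \<rightarrow>\<^sub>E {0, 1::nat})" .
    then have "\<not> (B k \<rightarrow>\<^sub>E {0, 1::nat}) \<subseteq> ?I"
      using card_mono[of ?I "B k \<rightarrow>\<^sub>E {0, 1}"] by auto
    then show ?thesis by blast
  qed
  then obtain w where w: "\<And>k. w k \<in> B k \<rightarrow>\<^sub>E {0, 1::nat}"
    "\<And>k i. i \<in> {1..m} \<Longrightarrow> c i = k \<Longrightarrow> w k \<noteq> restrict (v i) (B k)"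
    by (metis (mono_tags, lifting) DiffD1 DiffD2 imageI mem_Collect_eq)
  define u where "u = (\<lambda>j\<in>{1..n}. w (p j) j)"
  have "u \<in> bitvecs n" unfolding bitvecs_def u_def
  proof (rule restrict_PiE_iff[THEN iffD2], rule ballI)
    fix j assume "j \<in> {1..n}"
    then have "j \<in> B (p j)" by (simp add: B_def)
    then show "w (p j) j \<in> {0, 1}" using w(1) by blast
  qed
  moreover have "\<exists>j. (i, j) \<in> (SIGMA i:{1..m}. {j\<in>{1..n}. p j = c i}) \<and> u j \<noteq> v i j"
    if i: "i \<in> {1..m}" for i
  proof -
    obtain j where "w (c i) j \<noteq> restrict (v i) (B (c i)) j"
      using w(2)[OF i refl] by blast
    \<comment> \<open>Off the block both functions are \<open>undefined\<close>, so they can differ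
      only on it.\<close>
    moreover from this have "j \<in> B (c i)"
      using PiE_arb[OF w(1)[of "c i"], of j] by (auto simp: restrict_def split: if_splits)
    ultimately show ?thesis using i by (intro exI[of _ j]) (auto simp: B_def u_def)
  qed
  ultimately show "\<exists>u\<in>bitvecs n. \<forall>i\<in>{1..m}. \<exists>j. (i, j) \<in> (SIGMA i:{1..m}. {j\<in>{1..n}. p j = c i})
      \<and> u j \<noteq> v i j" by blast
qed auto

lemma div_fiber:
  assumes "0 < d"
  shows "{i. 1 \<le> i \<and> (i - 1) div d = k} = {k * d + 1..k * d + (d::nat)}"
proof -
  have "(i - 1) div d = k \<longleftrightarrow> i \<in> {k * d + 1..k * d + d}" if "1 \<le> i" for i
  proof -
    obtain i' where "i = Suc i'" using \<open>1 \<le> i\<close> by (cases i) auto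
    then show ?thesis using assms dividend_less_div_times[of d i']
      by (auto simp: algebra_simps Suc_le_eq less_Suc_eq_le intro!: div_nat_eqI)
  qed
  then show ?thesis using assms by (intro set_eqI) (metis (mono_tags, lifting) add_leE atLeastAtMost_iff
      le_add2 le_trans mem_Collect_eq)
qed

lemma oblivious_queries_le_blocks:
  assumes d: "0 < d" "d \<le> n" and m: "m \<le> (n div d) * (2 ^ d - 1)"
  shows "oblivious_queries n m \<le> m * d"
proof -
  define s :: nat where "s = 2 ^ d - 1"
  have s: "0 < s" unfolding s_def using one_less_power[of "2::nat" d] d by simp
  define p where "p j = (j - 1) div d" for j :: nat
  define c where "c i = (i - 1) div s" for i :: nat
  have full: "card {j\<in>{1..n}. p j = k} = d" if "k < n div d" for k
  proof -
    have "k * d + d \<le> n"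
      using mult_le_mono1[OF Suc_leI[OF that], of d] div_times_less_eq_dividend[of n d]
      unfolding mult_Suc by linarith
    then have "{j\<in>{1..n}. p j = k} = {j. 1 \<le> j \<and> (j - 1) div d = k}"
      unfolding p_def div_fiber[OF d(1)] using div_fiber[OF d(1), of k] by auto
    then show ?thesis unfolding div_fiber[OF d(1)] by simp
  qed
  have c: "c i < n div d" if "i \<in> {1..m}" for i
    unfolding c_def using that m s by (intro less_mult_imp_div_less) (auto simp: s_def)
  have "card {i\<in>{1..m}. c i = k} < 2 ^ card {j\<in>{1..n}. p j = k}" for k
  proof (cases "k < n div d")
    case True
    have "card {i\<in>{1..m}. c i = k} \<le> card {k * s + 1..k * s + s}"
      using div_fiber[OF s, of k] by (intro card_mono) (auto simp: c_def)
    then have "card {i\<in>{1..m}. c i = k} \<le> s" by simp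
    then show ?thesis using s unfolding full[OF True] by (simp add: s_def)
  next
    case False
    \<comment> \<open>The remainder block may have fewer than \<open>d\<close> coordinates, but it
      receives no vector.\<close>
    then have "{i\<in>{1..m}. c i = k} = {}" using c by auto
    then have "card {i\<in>{1..m}. c i = k} = 0" by (simp only: card.empty)
    then show ?thesis by (simp only: zero_less_power zero_less_numeral)
  qed
  then have "cantor_wins n m (SIGMA i:{1..m}. {j\<in>{1..n}. p j = c i})"
    by (rule cantor_wins_partition)
  moreover have "card (SIGMA i:{1..m}. {j\<in>{1..n}. p j = c i}) = m * d"
    using full[OF c] by (subst card_SigmaI) auto
  ultimately show ?thesis by (intro oblivious_queries_le) auto
qed

lemma oblivious_queries_le_all:
  assumes "m < 2 ^ n"
  shows "oblivious_queries n m \<le> m * n"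
  by (rule oblivious_queries_le[OF _ _ cantor_wins_all_queries[OF assms]]) auto

text \<open>Since \<open>n div d\<close> is at least n / (2d), it is enough that 1 + d x <= 2^d. The
  term 2 log L in the exponent makes 2^t = 2 x L^2 at the unrounded exponent \<open>t\<close>, which
  beats t x once L >= 3/2. For smaller \<open>L\<close> we have x < 3, and only \<open>d = 3\<close>
  needs an argument of its own, as 1 + 3x <= 8 may fail there.\<close>

lemma block_count_suffices:
  fixes L x :: real and d n m :: nat
  assumes n: "0 < n" "n < m" and x: "x = 2 * real m / real n" and L: "L = log 2 x"
    and d: "d = nat \<lceil>L + 2 * log 2 L + 1\<rceil>" and dn: "d \<le> n"
  shows "m \<le> (n div d) * (2 ^ d - 1)"
proof -
  define t where "t = L + 2 * log 2 L + 1"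
  have x2: "2 < x" using n by (simp add: x field_simps)
  have L1: "1 < L" using x2 unfolding L by simp
  then have logL: "0 < log 2 L" by simp
  have t2: "2 < t" using L1 logL unfolding t_def by linarith
  have dt: "real d \<ge> t" using t2 unfolding d t_def by linarith
  have d3: "3 \<le> d" using t2 dt by linarith
  have reduce: ?thesis if *: "1 + real d * x \<le> 2 ^ d"
  proof -
    have "1 \<le> n div d" using dn d3 by (simp add: Suc_le_eq div_greater_zero_iff)
    have "n = n div d * d + n mod d" by simp
    also have "\<dots> < n div d * d + d" using d3 by (intro add_strict_left_mono) simp
    also have "\<dots> \<le> 2 * (n div d * d)" using \<open>1 \<le> n div d\<close> by simp
    finally have "real n \<le> real (2 * (n div d * d))" by linarith
    then have nd: "real n / (2 * real d) \<le> real (n div d)" using d3 by (simp add: field_simps)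
    have "real m = real n / (2 * real d) * (real d * x)"
      using n d3 by (simp add: x)
    also have "\<dots> \<le> real (n div d) * (2 ^ d - 1)"
      using nd * x2 by (intro mult_mono) auto
    also have "\<dots> = real ((n div d) * (2 ^ d - 1))" by (simp add: of_nat_diff)
    finally show ?thesis by linarith
  qed
  show ?thesis
  proof (cases "3 / 2 \<le> L")
    case True
    have "ln L \<le> L - 1" using L1 by (intro ln_le_minus_one) simp
    moreover have "log 2 L * (2 / 3) \<le> log 2 L * ln 2"
      using logL ln2_ge_two_thirds by (intro mult_left_mono) auto
    then have "log 2 L * (2 / 3) \<le> ln L" by (simp add: log_def)
    ultimately have "log 2 L * (2 / 3) \<le> L - 1" by (rule order_trans[rotated])
    then have lL: "2 * log 2 L \<le> 3 * (L - 1)" by (simp add: field_simps)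
    \<comment> \<open>By \<open>lL\<close>, 1/2 + t <= 4L - 3/2, and this is at most 2 L^2 exactly
      when the product is nonnegative; hence the threshold 3/2.\<close>
    have "0 \<le> (2 * L - 3) * (2 * L - 1)" using True by (intro mult_nonneg_nonneg) auto
    then have "1 / 2 + t \<le> 2 * L\<^sup>2"
      using lL unfolding t_def by (simp add: algebra_simps power2_eq_square)
    then have "x * (1 / 2 + t) \<le> x * (2 * L\<^sup>2)" using x2 by (intro mult_left_mono) auto
    then have a: "1 + t * x \<le> 2 * x * L\<^sup>2" using x2 by (simp add: algebra_simps)
    have pt: "2 powr t = 2 * x * L\<^sup>2"
    proof -
      have "2 powr (2 * log 2 L) = L\<^sup>2"
        using L1 by (simp add: mult.commute[of 2] powr_powr[symmetric])
      then show ?thesis using x2 by (simp add: t_def powr_add) (simp add: L)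
    qed
    \<comment> \<open>The inequality survives rounding \<open>t\<close> up to \<open>d\<close>: the
      left side 1 + t x grows with slope \<open>x\<close>, while the right side grows at least
      linearly with slope (2/3) 2^t, which is at least \<open>x\<close>.\<close>
    have "1 + (real d - t) * (2 / 3) \<le> 1 + (real d - t) * ln 2"
      using dt ln2_ge_two_thirds by (intro add_left_mono mult_left_mono) auto
    also have "\<dots> \<le> 2 powr (real d - t)"
      unfolding powr_def using exp_ge_add_one_self[of "(real d - t) * ln 2"] by simp
    finally have "2 powr t * (1 + (real d - t) * (2 / 3)) \<le> 2 powr t * 2 powr (real d - t)"
      by (intro mult_left_mono) auto
    also have "\<dots> = 2 ^ d" by (simp flip: powr_add powr_realpow)
    finally have b: "2 powr t + (2 * x * L\<^sup>2 * (2 / 3)) * (real d - t) \<le> 2 ^ d"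
      unfolding pt by (simp add: algebra_simps)
    have "x * (3 / 2) \<le> x * L\<^sup>2"
      using x2 True mult_mono[OF True True] by (intro mult_left_mono) (auto simp: power2_eq_square)
    then have "x * (real d - t) \<le> (2 * x * L\<^sup>2 * (2 / 3)) * (real d - t)"
      using dt x2 by (intro mult_right_mono) auto
    then have "1 + t * x + x * (real d - t) \<le> 2 ^ d" using a b unfolding pt by linarith
    then have "1 + real d * x \<le> 2 ^ d" by (simp add: algebra_simps)
    then show ?thesis by (rule reduce)
  next
    case False
    have "x = 2 powr L" using x2 by (simp add: L)
    also have "\<dots> < 2 powr (3 / 2)" using False by simp
    also have "\<dots> \<le> 3"
    proof (rule power2_le_imp_le)
      have "((2::real) powr (3 / 2))\<^sup>2 = 2 powr 3" by (simp add: powr_power)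
      then show "((2::real) powr (3 / 2))\<^sup>2 \<le> 3\<^sup>2" by simp
    qed simp
    finally have x3: "x < 3" .
    show ?thesis
    proof (cases "d = 3")
      case d3: True
      \<comment> \<open>Otherwise (5/2)^10 > 2^13 gives L > 1.3, and 1.3^8 > 2^3 gives log L > 3/8,
        so t > 3.05, contradicting t <= d = 3.\<close>
      have "x \<le> 5 / 2"
      proof (rule ccontr)
        assume "\<not> x \<le> 5 / 2"
        then have x5: "5 / 2 < x" by simp
        have "13 = log 2 (2 ^ 13)" by (subst log_nat_power) auto
        also have "\<dots> < log 2 ((5 / 2) ^ 10)"
          by (subst log_less_cancel_iff) (auto simp: power_divide)
        also have "\<dots> = 10 * log 2 (5 / 2)" by (subst log_nat_power) auto
        also have "\<dots> < 10 * L" using x5 by (simp add: L)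
        finally have L13: "13 / 10 < L" by simp
        have "3 = log 2 (2 ^ 3)" by (subst log_nat_power) auto
        also have "\<dots> < log 2 ((13 / 10) ^ 8)"
          by (subst log_less_cancel_iff) (auto simp: power_divide)
        also have "\<dots> = 8 * log 2 (13 / 10)" by (subst log_nat_power) auto
        also have "\<dots> < 8 * log 2 L" using L13 by simp
        finally show False using L13 dt d3 unfolding t_def by simp
      qed
      then have m: "4 * m \<le> 5 * n" using n by (simp add: x field_simps)
      show ?thesis
      proof (cases "n \<le> 5")
        case True
        have "1 \<le> n div d" using dn d3 by (simp add: Suc_le_eq div_greater_zero_iff)
        then show ?thesis using m True d3 by simp
      next
        case False
        then show ?thesis using m unfolding d3 by simp
      qed
    next
      case False
      with d3 have d4: "4 \<le> d" by simp
      then have "4 * d \<le> 2 ^ d" by (induction d rule: nat_induct_at_least) auto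
      then have "4 * real d \<le> 2 ^ d" by (metis of_nat_le_iff of_nat_mult of_nat_numeral of_nat_power)
      moreover have "real d * x \<le> real d * 3" using x3 by (intro mult_left_mono) auto
      ultimately have "1 + real d * x \<le> 2 ^ d" using d4 by linarith
      then show ?thesis by (rule reduce)
    qed
  qed
qed

lemma oblivious_queries_upper:
  assumes "0 < n" "n < m" "m < 2 ^ n"
  shows "real (oblivious_queries n m)
    \<le> real m * of_int \<lceil>log 2 (2 * real m / real n) + 2 * log 2 (log 2 (2 * real m / real n)) + 1\<rceil>"
proof -
  define L where "L = log 2 (2 * real m / real n)"
  define d where "d = nat \<lceil>L + 2 * log 2 L + 1\<rceil>"
  have "1 < L" using assms unfolding L_def by (simp add: less_log_iff field_simps)
  then have "0 < log 2 L" by simp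
  have d: "real d = of_int \<lceil>L + 2 * log 2 L + 1\<rceil>" "0 < d"
    using \<open>1 < L\<close> \<open>0 < log 2 L\<close> unfolding d_def by linarith+
  have "oblivious_queries n m \<le> m * d"
  proof (cases "d \<le> n")
    case True
    then show ?thesis
      using block_count_suffices[OF assms(1,2) refl L_def d_def] d
      by (intro oblivious_queries_le_blocks) auto
  next
    case False
    \<comment> \<open>No block of size \<open>d\<close> fits, but asking for everything costs m n <=
      m d.\<close>
    then show ?thesis using oblivious_queries_le_all[OF assms(3)] mult_le_mono2[of n d m] by linarith
  qed
  then have "real (oblivious_queries n m) \<le> real m * real d"
    by (metis of_nat_le_iff of_nat_mult)
  then show ?thesis unfolding d L_def .
qed

subsection \<open>Lower bound\<close>

lemma log2_less:
  assumes "0 < m" "m < 2 ^ n"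
  shows "log 2 (real m) < real n"
proof -
  have "real m < real (2 ^ n)" using assms by (simp only: of_nat_less_iff)
  then show ?thesis using assms by (simp add: log_less_iff powr_realpow)
qed

text \<open>Averaging: restriction to \<open>S\<close> splits \<open>U\<close> into at most 2^|S|
  classes, and the largest has at least the average size.\<close>

lemma large_subcube:
  assumes U: "U \<subseteq> bitvecs n" and S: "S \<subseteq> {1..n}"
  shows "\<exists>x\<in>bitvecs n. real (card U) / 2 ^ card S \<le> real (card {u\<in>U. \<forall>j\<in>S. u j = x j})"
proof (cases "U = {}")
  case True
  have "(\<lambda>j\<in>{1..n}. 0) \<in> bitvecs n" by (auto simp: bitvecs_def)
  then show ?thesis using True by auto
next
  case False
  have fin: "finite U" using U finite_bitvecs finite_subset by blast
  have finS: "finite S" using S finite_subset by blast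
  show ?thesis
  proof (rule ccontr)
    assume "\<not> ?thesis"
    then have small: "real (card {u\<in>U. \<forall>j\<in>S. u j = x j}) < real (card U) / 2 ^ card S"
      if "x \<in> bitvecs n" for x using that by (meson not_le)
    let ?Y = "S \<rightarrow>\<^sub>E {0, 1::nat}"
    have Y: "finite ?Y" "card ?Y = 2 ^ card S" "?Y \<noteq> {}"
      using finS by (auto intro: finite_PiE simp: card_PiE numeral_2_eq_2 PiE_eq_empty_iff)
    \<comment> \<open>A nonempty class is the subcube around any of its own members, so the
      assumption applies to it; an empty one is below the average because \<open>U\<close> is
      nonempty.\<close>
    have lt: "real (card {u\<in>U. restrict u S = y}) < real (card U) / 2 ^ card S" for y
    proof (cases "{u\<in>U. restrict u S = y} = {}")
      case True
      then show ?thesis using \<open>U \<noteq> {}\<close> fin by (simp only:) (simp add: card_gt_0_iff)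
    next
      case False
      then obtain x where x: "x \<in> U" "restrict x S = y" by blast
      then have "{u\<in>U. restrict u S = y} = {u\<in>U. \<forall>j\<in>S. u j = x j}"
        by (auto simp: restrict_def) metis+
      then show ?thesis using small x U by auto
    qed
    have im: "(\<lambda>u. restrict u S) ` U \<subseteq> ?Y"
    proof (rule image_subsetI)
      fix u assume "u \<in> U"
      then have "u \<in> {1..n} \<rightarrow> {0, 1}" using U unfolding bitvecs_def by blast
      then have "u \<in> S \<rightarrow> {0, 1}" using S by blast
      then show "restrict u S \<in> ?Y" by auto
    qed
    have "card U = (\<Sum>y\<in>?Y. card {u\<in>U. restrict u S = y})"
      using sum.group[OF fin Y(1) im, of "\<lambda>_. 1::nat"] by simp
    then have "real (card U) = (\<Sum>y\<in>?Y. real (card {u\<in>U. restrict u S = y}))" by simp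
    also have "\<dots> < (\<Sum>y\<in>?Y. real (card U) / 2 ^ card S)"
      using lt Y by (intro sum_strict_mono) auto
    also have "\<dots> = real (card U)" using Y by simp
    finally show False by simp
  qed
qed

text \<open>Each new vector is placed by \<open>large_subcube\<close> applied to the points
  surviving so far, so the survivor count drops by the factor 1 - 2^(-|S a|).\<close>

lemma greedy_cover:
  assumes U: "U \<subseteq> bitvecs n" and T: "finite T" and S: "\<And>i. i \<in> T \<Longrightarrow> S i \<subseteq> {1..n}"
  shows "\<exists>v. (\<forall>i\<in>T. v i \<in> bitvecs n) \<and>
    real (card {u\<in>U. \<forall>i\<in>T. \<exists>j\<in>S i. u j \<noteq> v i j})
      \<le> real (card U) * (\<Prod>i\<in>T. 1 - 1 / 2 ^ card (S i))"
  using T S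
proof (induction T rule: finite_induct)
  case empty
  then show ?case by auto
next
  case (insert a T)
  then obtain v where v: "\<forall>i\<in>T. v i \<in> bitvecs n"
    and le: "real (card {u\<in>U. \<forall>i\<in>T. \<exists>j\<in>S i. u j \<noteq> v i j})
      \<le> real (card U) * (\<Prod>i\<in>T. 1 - 1 / 2 ^ card (S i))" by auto
  let ?W = "{u\<in>U. \<forall>i\<in>T. \<exists>j\<in>S i. u j \<noteq> v i j}"
  have W: "?W \<subseteq> bitvecs n" using U by auto
  then have fin: "finite ?W" using finite_bitvecs finite_subset by blast
  obtain x where x: "x \<in> bitvecs n"
    and big: "real (card ?W) / 2 ^ card (S a) \<le> real (card {u\<in>?W. \<forall>j\<in>S a. u j = x j})"
    using large_subcube[OF W insert.prems[of a]] by blast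
  let ?v = "v(a := x)"
  have eq: "{u\<in>U. \<forall>i\<in>insert a T. \<exists>j\<in>S i. u j \<noteq> ?v i j} = ?W - {u\<in>?W. \<forall>j\<in>S a. u j = x j}"
    using insert.hyps by auto
  have "card (?W - {u\<in>?W. \<forall>j\<in>S a. u j = x j}) = card ?W - card {u\<in>?W. \<forall>j\<in>S a. u j = x j}"
    by (intro card_Diff_subset finite_subset[OF _ fin]) auto
  moreover have "card {u\<in>?W. \<forall>j\<in>S a. u j = x j} \<le> card ?W" using fin by (intro card_mono) auto
  ultimately have "real (card (?W - {u\<in>?W. \<forall>j\<in>S a. u j = x j}))
      \<le> real (card ?W) * (1 - 1 / 2 ^ card (S a))"
    using big by (simp add: of_nat_diff algebra_simps)
  also have "\<dots> \<le> real (card U) * (\<Prod>i\<in>T. 1 - 1 / 2 ^ card (S i)) * (1 - 1 / 2 ^ card (S a))"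
    using le by (intro mult_right_mono) auto
  also have "\<dots> = real (card U) * (\<Prod>i\<in>insert a T. 1 - 1 / 2 ^ card (S i))"
    using insert.hyps by simp
  finally show ?case unfolding eq[symmetric] using v x by (intro exI[of _ ?v]) auto
qed

text \<open>Place the vectors of \<open>T\<close> greedily and bound the product by 1 - x <= exp
  (-x). If at most \<open>m - card T\<close> points survived, the vectors outside \<open>T\<close>
  could sit on them one by one and cover the cube. The summand 1 comes from integrality of the
  survivor count.\<close>

lemma cantor_wins_imp_survivors:
  assumes win: "cantor_wins n m Q" and Q: "Q \<subseteq> {1..m} \<times> {1..n}" and T: "T \<subseteq> {1..m}"
  shows "real (m - card T) + 1 \<le> 2 ^ n * exp (- (\<Sum>i\<in>T. 1 / 2 ^ card (Q `` {i})))"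
proof (rule ccontr)
  assume neg: "\<not> ?thesis"
  have fT: "finite T" using T finite_subset by blast
  have S: "Q `` {i} \<subseteq> {1..n}" for i using Q by auto
  from greedy_cover[of "bitvecs n" n T "\<lambda>i. Q `` {i}", OF subset_refl fT S]
  obtain v where v: "\<forall>i\<in>T. v i \<in> bitvecs n"
    and le: "real (card {u\<in>bitvecs n. \<forall>i\<in>T. \<exists>j\<in>Q `` {i}. u j \<noteq> v i j})
      \<le> real (card (bitvecs n)) * (\<Prod>i\<in>T. 1 - 1 / 2 ^ card (Q `` {i}))"
    by (elim exE conjE)
  let ?W = "{u\<in>bitvecs n. \<forall>i\<in>T. \<exists>j\<in>Q `` {i}. u j \<noteq> v i j}"
  have "(\<Prod>i\<in>T. 1 - 1 / 2 ^ card (Q `` {i})) \<le> (\<Prod>i\<in>T. exp (- (1 / 2 ^ card (Q `` {i})))::real)"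
  proof (rule prod_mono)
    fix i
    show "0 \<le> 1 - 1 / (2::real) ^ card (Q `` {i}) \<and>
        1 - 1 / (2::real) ^ card (Q `` {i}) \<le> exp (- (1 / 2 ^ card (Q `` {i})))"
      using exp_ge_add_one_self[of "- (1 / (2::real) ^ card (Q `` {i}))"] by simp
  qed
  also have "\<dots> = exp (- (\<Sum>i\<in>T. 1 / 2 ^ card (Q `` {i})))"
    by (simp add: exp_sum fT flip: sum_negf)
  finally have "real (card ?W) \<le> 2 ^ n * exp (- (\<Sum>i\<in>T. 1 / 2 ^ card (Q `` {i})))"
    using le by (simp add: card_bitvecs) (smt (verit) mult_left_mono zero_le_power)
  also have "\<dots> < real (m - card T) + 1" using neg by simp
  also have "m - card T = card ({1..m} - T)" using T fT by (simp add: card_Diff_subset)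
  finally have "card ?W \<le> card ({1..m} - T)" by linarith
  moreover have "finite ?W" using finite_bitvecs by simp
  ultimately obtain g where g: "g ` ?W \<subseteq> {1..m} - T" "inj_on g ?W"
    using card_le_inj[of ?W "{1..m} - T"] by auto
  have zero: "(\<lambda>j\<in>{1..n}. 0) \<in> bitvecs n" by (auto simp: bitvecs_def)
  \<comment> \<open>The injection \<open>g\<close> reserves a vector outside \<open>T\<close> for
    each survivor; vectors left over are set to zero.\<close>
  define v' where "v' = (\<lambda>i\<in>{1..m}. if i \<in> T then v i
    else if i \<in> g ` ?W then inv_into ?W g i else (\<lambda>j\<in>{1..n}. 0))"
  have "v' \<in> {1..m} \<rightarrow>\<^sub>E bitvecs n"
    unfolding v'_def restrict_PiE_iff using v zero inv_into_into[of _ g ?W] by auto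
  then obtain u where u: "u \<in> bitvecs n" "\<And>i. i \<in> {1..m} \<Longrightarrow> \<exists>j. (i, j) \<in> Q \<and> u j \<noteq> v' i j"
    using win unfolding cantor_wins_iff[OF Q] by blast
  have "\<exists>j\<in>Q `` {i}. u j \<noteq> v i j" if "i \<in> T" for i
    using u(2)[of i] that T by (force simp: v'_def)
  then have uW: "u \<in> ?W" using u(1) by blast
  then have gu: "g u \<in> {1..m} - T" using g(1) by blast
  then have "v' (g u) = u" using uW g(2) by (auto simp: v'_def)
  then show False using u(2)[of "g u"] gu by auto
qed

text \<open>A vector with no queried bit can never be excluded, so each vector costs at least one
  query.\<close>

lemma cantor_wins_imp_card_ge:
  assumes "cantor_wins n m Q" "Q \<subseteq> {1..m} \<times> {1..n}"
  shows "m \<le> card Q"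
proof -
  have fQ: "finite Q" using assms(2) finite_subset by blast
  have "(\<lambda>i. \<lambda>j\<in>{1..n}. 0) \<in> UNIV \<rightarrow> bitvecs n" by (auto simp: bitvecs_def)
  then have "(\<lambda>i\<in>{1..m}. \<lambda>j\<in>{1..n}. 0) \<in> {1..m} \<rightarrow>\<^sub>E bitvecs n" by auto
  then have "\<forall>i\<in>{1..m}. \<exists>j. (i, j) \<in> Q" using assms unfolding cantor_wins_iff[OF assms(2)] by blast
  then have "{1..m} \<subseteq> fst ` Q" by force
  then have "card {1..m} \<le> card (fst ` Q)" using fQ by (intro card_mono) auto
  also have "\<dots> \<le> card Q" using fQ by (rule card_image_le)
  finally show ?thesis by simp
qed

lemma cantor_wins_imp_card_lower:
  assumes n: "0 < n" "n < m" "m < 2 ^ n" and win: "cantor_wins n m Q" and Q: "Q \<subseteq> {1..m} \<times> {1..n}"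
  shows "real m * (log 2 (real m / (real n - log 2 (real m) + 1)) - 1) \<le> real (card Q)"
proof (rule ccontr)
  \<comment> \<open>\<open>N\<close> is chosen so that 2^(n - N) = m / 2, and \<open>a\<close> so
    that m 2^(-a) = 2N.\<close>
  define N where "N = real n - log 2 (real m) + 1"
  define d where "d i = real (card (Q `` {i}))" for i
  define w where "w i = 1 / (2::real) ^ card (Q `` {i})" for i
  define a where "a = log 2 (real m / N) - 1"
  assume "\<not> ?thesis"
  then have less: "real (card Q) < real m * a" by (simp add: a_def N_def)
  have "log 2 (real m) < real n" using log2_less[of m n] n by simp
  then have N: "1 < N" by (simp add: N_def)
  have fQ: "finite Q" using Q finite_subset by blast
  have "card Q = card (SIGMA i:{1..m}. Q `` {i})" using Q by (intro arg_cong[of _ _ card]) auto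
  also have "\<dots> = (\<Sum>i\<in>{1..m}. card (Q `` {i}))" using fQ by (intro card_SigmaI) auto
  finally have cQ: "real (card Q) = (\<Sum>i\<in>{1..m}. d i)" by (simp add: d_def)
  have pa: "2 powr (- a) = 2 * N / real m"
    using n N by (simp add: a_def powr_diff powr_minus)
  \<comment> \<open>The convex function 2^(-x) lies above its tangent at \<open>a\<close>. Summed
    over \<open>i\<close>, where the average of the \<open>d i\<close> is below \<open>a\<close>,
    this gives total weight above 2N.\<close>
  have tangent: "2 powr (- a) * (1 - (d i - a) * ln 2) \<le> w i" for i
  proof -
    have "1 - (d i - a) * ln 2 \<le> 2 powr (- (d i - a))"
      unfolding powr_def using exp_ge_add_one_self[of "- (d i - a) * ln 2"]
      by (simp add: algebra_simps)
    then have "2 powr (- a) * (1 - (d i - a) * ln 2) \<le> 2 powr (- a) * 2 powr (- (d i - a))"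
      by (intro mult_left_mono) auto
    also have "\<dots> = 2 powr (- d i)" by (simp flip: powr_add)
    also have "\<dots> = w i" by (simp add: w_def d_def powr_minus_divide powr_realpow)
    finally show ?thesis .
  qed
  have "2 * N = real m * 2 powr (- a)" using n unfolding pa by simp
  also have "\<dots> < 2 powr (- a) * (real m - (real (card Q) - real m * a) * ln 2)"
    using less by (simp add: algebra_simps)
  also have "\<dots> = (\<Sum>i\<in>{1..m}. 2 powr (- a) * (1 - (d i - a) * ln 2))"
    by (simp add: cQ sum_subtractf flip: sum_distrib_left sum_distrib_right)
  also have "\<dots> \<le> (\<Sum>i\<in>{1..m}. w i)" by (intro sum_mono tangent)
  finally have sum: "2 * N < (\<Sum>i\<in>{1..m}. w i)" .
  have few: "real (m - card T) + 1 \<le> real m / 2" if T: "T \<subseteq> {1..m}" and wT: "N \<le> (\<Sum>i\<in>T. w i)" for T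
  proof -
    have "real (m - card T) + 1 \<le> 2 ^ n * exp (- (\<Sum>i\<in>T. w i))"
      using cantor_wins_imp_survivors[OF win Q T] unfolding w_def .
    also have "\<dots> \<le> 2 ^ n * exp (- N * ln 2)"
    proof -
      have "N * ln 2 \<le> N * 1" using N ln_2_less_1 by (intro mult_left_mono) auto
      then show ?thesis using wT by simp
    qed
    also have "\<dots> = 2 powr (real n - N)" by (simp add: powr_diff powr_realpow) (simp add: powr_def exp_minus divide_simps)
    also have "real n - N = log 2 (real m) - 1" by (simp add: N_def)
    also have "2 powr \<dots> = real m / 2" using n by (simp add: powr_diff)
    finally show ?thesis .
  qed
  define H where "H = {1..m div 2}"
  have H: "H \<subseteq> {1..m}" "card H = m div 2" by (auto simp: H_def)
  have split: "(\<Sum>i\<in>{1..m}. w i) = (\<Sum>i\<in>{1..m} - H. w i) + (\<Sum>i\<in>H. w i)"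
    using H by (intro sum.subset_diff) auto
  have H': "card ({1..m} - H) = m - m div 2" using H by (subst card_Diff_subset) (auto simp: H_def)
  show False
  \<comment> \<open>One half has weight at least \<open>N\<close>. The other half has at least
    \<open>m div 2\<close> vectors, and \<open>m div 2 + 1\<close> exceeds m / 2 for either parity,
    contradicting \<open>few\<close>.\<close>
  proof (cases "N \<le> (\<Sum>i\<in>H. w i)")
    case True
    from few[OF H(1) this] show ?thesis unfolding H(2) by linarith
  next
    case False
    then have "N \<le> (\<Sum>i\<in>{1..m} - H. w i)" using sum split by linarith
    from few[OF _ this] show ?thesis unfolding H' by (simp add: of_nat_diff)
  qed
qed

lemma oblivious_queries_lower:
  assumes "0 < n" "n < m" "m < 2 ^ n"
  shows "real m * (log 2 (real m / (real n - log 2 (real m) + 1)) - 1) \<le> real (oblivious_queries n m)"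
proof -
  obtain Q where Q: "Q \<subseteq> {1..m} \<times> {1..n}" "card Q \<le> oblivious_queries n m" "cantor_wins n m Q"
    using oblivious_queries_attained[OF assms(3)] by blast
  show ?thesis using cantor_wins_imp_card_lower[OF assms Q(3,1)] Q(2) by linarith
qed

section \<open>The exact value for m <= n and the asymptotic form\<close>

lemma oblivious_queries_ge:
  assumes "m < 2 ^ n"
  shows "m \<le> oblivious_queries n m"
  using oblivious_queries_attained[OF assms] cantor_wins_imp_card_ge le_trans by blast

text \<open>Blocks of size 1 evade one vector per coordinate, which is enough for m <= n.\<close>

lemma oblivious_queries_eq:
  assumes "0 < n" "m < 2 ^ n" "m \<le> n"
  shows "oblivious_queries n m = m"
  using oblivious_queries_le_blocks[of 1 n m] oblivious_queries_ge[of m n] assms by simp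

text \<open>Both bounds depend on m / n alone, which makes the error term uniform. Above, the 3
  collects the additive 1, the factor 2 inside the logarithm and the rounding up. Below, one unit is
  the -1 of the lower bound and the other comes from \<lceil>y\<rceil> <= 2y.\<close>

lemma oblivious_queries_deviation:
  assumes n: "0 < n" "n < m" "m < 2 ^ n"
  defines "y \<equiv> real m / real n"
  defines "r \<equiv> real (oblivious_queries n m) / real m - log 2 (of_int \<lceil>y\<rceil>)"
  shows "- 2 \<le> r" "r \<le> 2 * log 2 (log 2 (2 * y)) + 3"
proof -
  have y: "1 < y" using n by (simp add: y_def)
  have "log 2 y \<le> log 2 (of_int \<lceil>y\<rceil>)" using y by (subst log_le_cancel_iff) linarith+
  moreover have "real (oblivious_queries n m)
      \<le> real m * of_int \<lceil>log 2 (2 * y) + 2 * log 2 (log 2 (2 * y)) + 1\<rceil>"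
    using oblivious_queries_upper[OF n] unfolding y_def by simp
  then have "real (oblivious_queries n m) / real m
      \<le> of_int \<lceil>log 2 (2 * y) + 2 * log 2 (log 2 (2 * y)) + 1\<rceil>"
    using n by (simp add: divide_le_eq mult.commute)
  moreover have "log 2 (2 * y) = 1 + log 2 y" using y by (simp add: log_mult)
  ultimately show "r \<le> 2 * log 2 (log 2 (2 * y)) + 3"
    unfolding r_def by linarith
  have "of_int \<lceil>y\<rceil> \<le> 2 * y" using y by linarith
  then have "log 2 (of_int \<lceil>y\<rceil>) \<le> log 2 (2 * y)" using y by (subst log_le_cancel_iff) linarith+
  then have up: "log 2 (of_int \<lceil>y\<rceil>) \<le> 1 + log 2 y" using y by (simp add: log_mult)
  have "log 2 (real m) < real n" using log2_less[of m n] n by simp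
  \<comment> \<open>As m >= 2, the denominator n - log m + 1 is at most \<open>n\<close>.\<close>
  moreover have "log 2 2 \<le> log 2 (real m)" using n by (subst log_le_cancel_iff) auto
  ultimately have "y \<le> real m / (real n - log 2 (real m) + 1)"
    "0 < real m / (real n - log 2 (real m) + 1)"
    unfolding y_def using n by (auto intro!: divide_left_mono divide_pos_pos mult_pos_pos)
  then have "log 2 y \<le> log 2 (real m / (real n - log 2 (real m) + 1))"
    using y by (subst log_le_cancel_iff) auto
  then have "real m * (log 2 y - 1) \<le> real m * (log 2 (real m / (real n - log 2 (real m) + 1)) - 1)"
    by (intro mult_left_mono) auto
  then have "real m * (log 2 y - 1) \<le> real (oblivious_queries n m)"
    using oblivious_queries_lower[OF n] by linarith
  then have "log 2 y - 1 \<le> real (oblivious_queries n m) / real m"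
    using n by (simp add: le_divide_eq mult.commute)
  then show "- 2 \<le> r" using up unfolding r_def by linarith
qed

text \<open>Reduces a claim along \<open>large_ratio\<close> to an asymptotic statement in one real
  variable, the ratio m / n.\<close>

lemma eventually_large_ratio:
  assumes "eventually P at_top"
    and "\<And>n m. 0 < n \<Longrightarrow> n < m \<Longrightarrow> m < 2 ^ n \<Longrightarrow> P (real m / real n) \<Longrightarrow> R (n, m)"
  shows "eventually R large_ratio"
  unfolding large_ratio_def eventually_inf_principal eventually_filtercomap
  using assms by (intro exI[of _ P]) auto

theorem theorem3p2:
  "(\<forall>n m. 0 < n \<and> 0 < m \<and> m < 2 ^ n \<and> m \<le> n \<longrightarrow> oblivious_queries n m = m) \<and>
   (\<exists>r :: nat \<times> nat \<Rightarrow> real.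
      r \<in> o[large_ratio](\<lambda>(n, m). log 2 (of_int \<lceil>real m / real n\<rceil>)) \<and>
      (\<forall>n m. 0 < n \<and> n < m \<and> m < 2 ^ n \<longrightarrow>
         real (oblivious_queries n m) =
           real m * (log 2 (of_int \<lceil>real m / real n\<rceil>) + r (n, m)))) \<and>
   (\<forall>n m. 0 < n \<and> n < m \<and> m < 2 ^ n \<longrightarrow>
      real m * (log 2 (real m / (real n - log 2 (real m) + 1)) - 1)
        \<le> real (oblivious_queries n m) \<and>
      real (oblivious_queries n m)
        \<le> real m * of_int \<lceil>log 2 (2 * real m / real n)
                            + 2 * log 2 (log 2 (2 * real m / real n)) + 1\<rceil>)"
proof (intro conjI)
  show "\<forall>n m. 0 < n \<and> 0 < m \<and> m < 2 ^ n \<and> m \<le> n \<longrightarrow> oblivious_queries n m = m"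
    using oblivious_queries_eq by blast
next
  \<comment> \<open>The required identity forces this error term for n < m < 2^n; what remains is
    its size.\<close>
  define r where "r = (\<lambda>(n, m).
    real (oblivious_queries n m) / real m - log 2 (of_int \<lceil>real m / real n\<rceil>))"
  have "r \<in> o[large_ratio](\<lambda>(n, m). log 2 (of_int \<lceil>real m / real n\<rceil>))"
  proof (rule landau_o.smallI)
    fix c :: real assume c: "0 < c"
    have "\<forall>\<^sub>F y in at_top. 2 * log 2 (log 2 (2 * y)) + 3 \<le> c * log 2 y"
      using c by real_asymp
    moreover have "\<forall>\<^sub>F y in at_top. 2 \<le> c * log 2 y"
      using c by real_asymp
    ultimately have "\<forall>\<^sub>F y in at_top. 2 * log 2 (log 2 (2 * y)) + 3 \<le> c * log 2 y \<and> 2 \<le> c * log 2 y"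
      by (rule eventually_conj)
    then show "\<forall>\<^sub>F p in large_ratio.
        norm (r p) \<le> c * norm (case p of (n, m) \<Rightarrow> log 2 (real_of_int \<lceil>real m / real n\<rceil>))"
    proof (rule eventually_large_ratio)
      fix n m :: nat
      assume n: "0 < n" "n < m" "m < 2 ^ n"
      define y where "y = real m / real n"
      assume y: "2 * log 2 (log 2 (2 * (real m / real n))) + 3 \<le> c * log 2 (real m / real n) \<and>
        2 \<le> c * log 2 (real m / real n)"
      have "1 < y" using n by (simp add: y_def)
      then have "0 \<le> log 2 y" by simp
      have "log 2 y \<le> log 2 (of_int \<lceil>y\<rceil>)"
        using \<open>1 < y\<close> by (subst log_le_cancel_iff) linarith+
      then have "c * log 2 y \<le> c * log 2 (of_int \<lceil>y\<rceil>)" using c by simp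
      then have "\<bar>r (n, m)\<bar> \<le> c * log 2 (of_int \<lceil>y\<rceil>)"
        using oblivious_queries_deviation[OF n] y unfolding r_def y_def by auto
      also have "\<dots> = c * \<bar>log 2 (of_int \<lceil>y\<rceil>)\<bar>"
        using \<open>0 \<le> log 2 y\<close> \<open>log 2 y \<le> log 2 (of_int \<lceil>y\<rceil>)\<close> by simp
      finally show "norm (r (n, m))
          \<le> c * norm (case (n, m) of (n, m) \<Rightarrow> log 2 (real_of_int \<lceil>real m / real n\<rceil>))"
        by (simp add: y_def)
    qed
  qed
  then show "\<exists>r :: nat \<times> nat \<Rightarrow> real.
      r \<in> o[large_ratio](\<lambda>(n, m). log 2 (of_int \<lceil>real m / real n\<rceil>)) \<and>
      (\<forall>n m. 0 < n \<and> n < m \<and> m < 2 ^ n \<longrightarrow>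
         real (oblivious_queries n m) =
           real m * (log 2 (of_int \<lceil>real m / real n\<rceil>) + r (n, m)))"
    by (intro exI[of _ r]) (auto simp: r_def)
next
  show "\<forall>n m. 0 < n \<and> n < m \<and> m < 2 ^ n \<longrightarrow>
      real m * (log 2 (real m / (real n - log 2 (real m) + 1)) - 1)
        \<le> real (oblivious_queries n m) \<and>
      real (oblivious_queries n m)
        \<le> real m * of_int \<lceil>log 2 (2 * real m / real n)
                            + 2 * log 2 (log 2 (2 * real m / real n)) + 1\<rceil>"
    using oblivious_queries_lower oblivious_queries_upper by blast
qed

end
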